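(* Let $A\in\mathbb{R}^{m\times n}$ be semi-monotone and let $A=P_1-R_1+S_1=P_2-R_2+S_2=P_3-R_3+S_3=P_4-R_4+S_4$ be four double proper weak regular splittings of $A$. Suppose $N(S_2)\supseteq N(P_2)$, $R(S_2)\subseteq R(P_2)$, $N(S_4)\supseteq N(P_4)$, $R(S_4)\subseteq R(P_4)$, $1\notin\sigma(S_2P_1^{\dagger})$ and $1\notin\sigma(S_4P_3^{\dagger})$. Define $\widehat{A}_1=(I-S_2P_1^{\dagger})A$, $\widehat{P}_1=P_2$, $\widehat{R}_1=R_2-S_2P_1^{\dagger}R_1$, and $\widehat{A}_2=(I-S_4P_3^{\dagger})A$, $\widehat{P}_2=P_4$, $\widehat{R}_2=R_4-S_4P_3^{\dagger}R_3$, and suppose $\widehat{A}_i^{\dagger}\geq 0$ for $i=1,2$. If $\widehat{P}_1^{\dagger}\widehat{A}_1\geq\widehat{P}_2^{\dagger}\widehat{A}_2$ and $\widehat{P}_1^{\dagger}\widehat{R}_1\geq\widehat{P}_2^{\dagger}\widehat{R}_2$, then $\rho(W_{12})\leq\rho(W_{34})<1$, where $$W_{12}=\begin{pmatrix} P_2^{\dagger}R_2-P_2^{\dagger}S_2P_1^{\dagger}R_1 & P_2^{\dagger}S_2P_1^{\dagger}S_1\\ I & 0\end{pmatrix},\qquad W_{34}=\begin{pmatrix} P_4^{\dagger}R_4-P_4^{\dagger}S_4P_3^{\dagger}R_3 & P_4^{\dagger}S_4P_3^{\dagger}S_3\\ I & 0\end{pmatrix}.$$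
   Context: For $M\in\mathbb{R}^{m\times n}$, $M^{\dagger}$ is its Moore–Penrose inverse, $R(M)$, $N(M)$ its range and null space; inequalities are entrywise; $\rho$ is the spectral radius, $\sigma$ the spectrum. $A$ is semi-monotone if $A^{\dagger}\geq0$. A double splitting $A=P-R+S$ is a double proper splitting if $R(P)=R(A)$ and $N(P)=N(A)$; it is double proper weak regular if moreover $P^{\dagger}\geq 0$, $P^{\dagger}R\geq 0$, $P^{\dagger}S\leq 0$. *)

theory Defs
  imports "Jordan_Normal_Form.Spectral_Radius" "Jordan_Normal_Form.Matrix_Kernel"
begin

definition mat_range :: "real mat \<Rightarrow> real vec set" where
  "mat_range A = {A *\<^sub>v x | x. x \<in> carrier_vec (dim_col A)}"

definition mp_inverse :: "real mat \<Rightarrow> real mat" where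
  "mp_inverse A = (THE X. X \<in> carrier_mat (dim_col A) (dim_row A) \<and>
      A * X * A = A \<and> X * A * X = X \<and>
      transpose_mat (A * X) = A * X \<and> transpose_mat (X * A) = X * A)"

definition nonneg_mat :: "real mat \<Rightarrow> bool" where
  "nonneg_mat M = (0\<^sub>m (dim_row M) (dim_col M) \<le> M)"

definition nonpos_mat :: "real mat \<Rightarrow> bool" where
  "nonpos_mat M = (M \<le> 0\<^sub>m (dim_row M) (dim_col M))"

definition semi_monotone :: "real mat \<Rightarrow> bool" where
  "semi_monotone A = nonneg_mat (mp_inverse A)"

definition rspectrum :: "real mat \<Rightarrow> complex set" where
  "rspectrum M = spectrum (map_mat complex_of_real M)"

definition rspectral_radius :: "real mat \<Rightarrow> real" where
  "rspectral_radius M = spectral_radius (map_mat complex_of_real M)"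

definition double_splitting :: "nat \<Rightarrow> nat \<Rightarrow> real mat \<Rightarrow> real mat \<Rightarrow> real mat \<Rightarrow> real mat \<Rightarrow> bool" where
  "double_splitting m n A P R S = (A \<in> carrier_mat m n \<and> P \<in> carrier_mat m n \<and>
      R \<in> carrier_mat m n \<and> S \<in> carrier_mat m n \<and> A = P - R + S)"

definition double_proper_splitting :: "nat \<Rightarrow> nat \<Rightarrow> real mat \<Rightarrow> real mat \<Rightarrow> real mat \<Rightarrow> real mat \<Rightarrow> bool" where
  "double_proper_splitting m n A P R S = (double_splitting m n A P R S \<and>
      mat_range P = mat_range A \<and> mat_kernel P = mat_kernel A)"

definition double_proper_weak_regular :: "nat \<Rightarrow> nat \<Rightarrow> real mat \<Rightarrow> real mat \<Rightarrow> real mat \<Rightarrow> real mat \<Rightarrow> bool" where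
  "double_proper_weak_regular m n A P R S = (double_proper_splitting m n A P R S \<and>
      nonneg_mat (mp_inverse P) \<and> nonneg_mat (mp_inverse P * R) \<and> nonpos_mat (mp_inverse P * S))"

definition iter_mat :: "nat \<Rightarrow> real mat \<Rightarrow> real mat \<Rightarrow> real mat \<Rightarrow> real mat \<Rightarrow> real mat \<Rightarrow> real mat \<Rightarrow> real mat" where
  "iter_mat n P1 R1 S1 P2 R2 S2 = four_block_mat
     (mp_inverse P2 * R2 - mp_inverse P2 * S2 * mp_inverse P1 * R1)
     (mp_inverse P2 * S2 * mp_inverse P1 * S1)
     (1\<^sub>m n) (0\<^sub>m n n)"

end

theory Submission
  imports Defs
begin

text \<open>Write each iteration matrix as the block companion matrix of \<open>(X, Y)\<close>. Both blocks are
  nonnegative, and \<open>X + Y = P\<^sub>2\<^sup>\<dagger> P\<^sub>2 - P\<^sub>2\<^sup>\<dagger> H\<close> where \<open>H\<close> is the matrix called \<open>A\<close>-hat in the paper, so the two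
  comparison hypotheses give \<open>X\<^sub>1 \<ge> X\<^sub>2\<close> and \<open>X\<^sub>1 + Y\<^sub>1 \<le> X\<^sub>2 + Y\<^sub>2\<close>. Entrywise moduli of a left
  eigenvector yield, for the spectral radius \<open>r > 0\<close>, a nonzero \<open>u \<ge> 0\<close> with
  \<open>r\<^sup>2 u \<le> (r X + Y)\<^sup>T u\<close>; conversely such a \<open>u\<close> forces the spectral radius to be at least \<open>r\<close>,
  because powers of a matrix of spectral radius below one are bounded. As
  \<open>r X\<^sub>1 + Y\<^sub>1 \<le> r X\<^sub>2 + Y\<^sub>2\<close> for \<open>r \<le> 1\<close>, the comparison follows. If \<open>r \<ge> 1\<close>, then
  \<open>u \<le> T\<^sup>T u\<close> for \<open>T = X + Y\<close>, and \<open>H\<^sup>\<dagger> = P\<^sub>2\<^sup>\<dagger> + T H\<^sup>\<dagger>\<close> with nonnegative \<open>H\<^sup>\<dagger>\<close> and \<open>P\<^sub>2\<^sup>\<dagger>\<close> gives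
  \<open>u\<^sup>T P\<^sub>2\<^sup>\<dagger> = 0\<close>; since \<open>T\<close> is a right multiple of \<open>P\<^sub>2\<^sup>\<dagger>\<close>, this forces \<open>u = 0\<close>.\<close>

section \<open>Moore--Penrose inverses\<close>

text \<open>Dimension equations in place of carrier memberships let the simplifier regroup a long
  product once the dimensions of its factors are known.\<close>

lemma mat_mult_assoc:
  fixes A B C :: "'a :: semiring_0 mat"
  assumes "dim_col A = dim_row B" "dim_col B = dim_row C"
  shows "A * B * C = A * (B * C)"
  using assms assoc_mult_mat[of A "dim_row A" "dim_row B" B "dim_row C" C "dim_col C"]
  by (metis carrier_matI)

lemma mat_transpose_mult:
  fixes A B :: "'a :: comm_semiring_0 mat"
  assumes "dim_col A = dim_row B"
  shows "transpose_mat (A * B) = transpose_mat B * transpose_mat A"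
  using assms transpose_mult[of A "dim_row A" "dim_row B" B "dim_col B"]
  by (metis carrier_matI)

lemma mat_diff_mult_distrib:
  fixes A B C :: "'a :: ring mat"
  assumes "dim_row A = dim_row B" "dim_col A = dim_col B" "dim_col B = dim_row C"
  shows "(A - B) * C = A * C - B * C"
  using assms minus_mult_distrib_mat[of A "dim_row B" "dim_row C" B C "dim_col C"]
  by (metis carrier_matI)

lemma mat_mult_diff_distrib:
  fixes A B C :: "'a :: ring mat"
  assumes "dim_row B = dim_row C" "dim_col B = dim_col C" "dim_col A = dim_row B"
  shows "A * (B - C) = A * B - A * C"
  using assms mult_minus_distrib_mat[of A "dim_row A" "dim_row C" B "dim_col C" C]
  by (metis carrier_matI)

lemma mat_add_mult_distrib:
  fixes A B C :: "'a :: semiring_0 mat"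
  assumes "dim_row A = dim_row B" "dim_col A = dim_col B" "dim_col B = dim_row C"
  shows "(A + B) * C = A * C + B * C"
  using assms add_mult_distrib_mat[of A "dim_row B" "dim_row C" B C "dim_col C"]
  by (metis carrier_matI)

lemma mat_mult_add_distrib:
  fixes A B C :: "'a :: semiring_0 mat"
  assumes "dim_row B = dim_row C" "dim_col B = dim_col C" "dim_col A = dim_row B"
  shows "A * (B + C) = A * B + A * C"
  using assms mult_add_distrib_mat[of A "dim_row A" "dim_row C" B "dim_col C" C]
  by (metis carrier_matI)

lemmas mat_algebra = mat_mult_assoc mat_diff_mult_distrib mat_mult_diff_distrib
  mat_add_mult_distrib mat_mult_add_distrib mat_transpose_mult

section \<open>Generalized inverses and least squares\<close>

text \<open>Row reduction gives \<open>C = P * A\<close> with \<open>P\<close> invertible; a 0/1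
  matrix \<open>Y\<close> read off the pivots satisfies \<open>C * Y * C = C\<close>, and then
  \<open>Y * P\<close> works for \<open>A\<close>.\<close>

lemma generalized_inverse_exists:
  fixes A :: "'a :: field mat"
  assumes A: "A \<in> carrier_mat m n"
  shows "\<exists>G \<in> carrier_mat n m. A * G * A = A"
proof -
  define C where "C = gauss_jordan_single A"
  note gj = gauss_jordan_single[OF A C_def[symmetric]]
  obtain P Q where C: "C = P * A" and PQ: "P \<in> carrier_mat m m" "Q \<in> carrier_mat m m"
    "P * Q = 1\<^sub>m m" "Q * P = 1\<^sub>m m"
    using gj(4) by blast
  obtain f where f: "pivot_fun C f n"
    using gj(2,3) by (auto simp: row_echelon_form_def)
  have dC: "dim_row C = m" "dim_col C = n" using gj(2) by auto
  note p = pivot_funD[OF dC(1) f]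
  \<comment> \<open>Column \<open>i\<close> of \<open>Y\<close> is the unit vector at the pivot of
    row \<open>i\<close>; a zero row has \<open>f i = n\<close>, so its column of \<open>Y\<close>
    is zero.\<close>
  define Y :: "'a mat" where "Y = mat n m (\<lambda>(j, i). if f i = j then 1 else 0)"
  have Y: "Y \<in> carrier_mat n m" by (simp add: Y_def)
  \<comment> \<open>\<open>C * Y\<close> is the diagonal projection onto the rows with a pivot; all
    other rows of \<open>C\<close> vanish, so it fixes \<open>C\<close>.\<close>
  have CY: "C * Y = mat m m (\<lambda>(i, k). if f k < n \<and> i = k then 1 else 0)"
  proof (rule eq_matI, goal_cases)
    case (1 i k)
    then have ik: "i < m" "k < m" by auto
    have "(C * Y) $$ (i, k) = (\<Sum>j<n. C $$ (i, j) * (if f k = j then 1 else 0))"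
      using ik dC by (simp add: scalar_prod_def Y_def atLeast0LessThan)
    also have "\<dots> = (\<Sum>j<n. if f k = j then C $$ (i, j) else 0)"
      by (rule sum.cong) auto
    also have "\<dots> = (if f k < n then C $$ (i, f k) else 0)"
      by (simp add: sum.delta')
    also have "\<dots> = (if f k < n \<and> i = k then 1 else 0)"
      using p(4)[OF ik(2)] p(5)[OF ik(2) _ ik(1)] by auto
    finally show ?case using ik by simp
  qed (auto simp: dC Y_def)
  have "C * Y * C = C"
    unfolding CY
  proof (rule eq_matI, goal_cases)
    case (1 i j)
    then have ij: "i < m" "j < n" using dC by auto
    have "(mat m m (\<lambda>(i, k). if f k < n \<and> i = k then 1 else 0) * C) $$ (i, j)
        = (\<Sum>k<m. (if f k < n \<and> i = k then 1 else 0) * C $$ (k, j))"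
      using ij dC by (simp add: scalar_prod_def atLeast0LessThan)
    also have "\<dots> = (\<Sum>k<m. if i = k then (if f k < n then C $$ (k, j) else 0) else 0)"
      by (rule sum.cong) auto
    also have "\<dots> = (if f i < n then C $$ (i, j) else 0)"
      using ij by (simp add: sum.delta')
    also have "\<dots> = C $$ (i, j)"
      using p(1)[OF ij(1)] p(2)[OF ij(1), of j] ij by auto
    finally show ?case by simp
  qed (auto simp: dC)
  then have "Q * (P * A * Y * (P * A)) = Q * (P * A)" by (simp add: C)
  moreover have "Q * (P * A * Y * (P * A)) = (Q * P) * (A * (Y * P) * A)"
    and "Q * (P * A) = (Q * P) * A"
    using A PQ(1,2) Y by (simp_all add: mat_mult_assoc)
  ultimately have "A * (Y * P) * A = A"
    using A PQ Y by simp
  then show ?thesis using Y PQ by (intro bexI[of _ "Y * P"]) auto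
qed

text \<open>(A M)^T (A M) = M^T (A^T A M) = 0, and the diagonal of the left side holds the squared
  norms of the columns of A M.\<close>

lemma gram_mult_eq_0_imp:
  fixes A M :: "real mat"
  assumes A: "A \<in> carrier_mat m n" and M: "M \<in> carrier_mat n k"
    and 0: "transpose_mat A * A * M = 0\<^sub>m n k"
  shows "A * M = 0\<^sub>m m k"
proof -
  define V where "V = A * M"
  have V: "V \<in> carrier_mat m k" using A M by (auto simp: V_def)
  have "transpose_mat V * V = transpose_mat M * (transpose_mat A * A * M)"
    using A M by (simp add: V_def mat_algebra)
  then have VV: "transpose_mat V * V = 0\<^sub>m k k" using M by (simp add: 0)
  have "col V j = 0\<^sub>v m" if "j < k" for j
  proof -
    have "col V j \<bullet> col V j = (transpose_mat V * V) $$ (j, j)"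
      using that V by simp
    then have "col V j \<bullet> col V j = 0" using that by (simp add: VV)
    then have "col V j \<bullet>c col V j = 0" by simp
    then show ?thesis using conjugate_square_eq_0_vec[of "col V j" m] V by auto
  qed
  then have "V $$ (i, j) = 0" if "i < m" "j < k" for i j
    using that V by (metis carrier_matD index_col index_zero_vec(1))
  then show ?thesis unfolding V_def[symmetric] using V by (intro eq_matI) auto
qed

text \<open>The witness is G A^T, for \<open>G\<close> a generalized inverse of the Gram matrix A^T
  A.\<close>

lemma least_squares_inverse_exists:
  fixes A :: "real mat"
  assumes A: "A \<in> carrier_mat m n"
  shows "\<exists>X \<in> carrier_mat n m. A * X * A = A \<and> transpose_mat (A * X) = A * X"
proof -
  let ?B = "transpose_mat A * A"
  obtain G where G: "G \<in> carrier_mat n n" and BGB: "?B * G * ?B = ?B"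
    using generalized_inverse_exists[of ?B n n] A by auto
  note d = carrier_matD[OF A] carrier_matD[OF G]
  \<comment> \<open>Cancelling the Gram matrix down to \<open>A\<close> upgrades \<open>BGB\<close>
    to \<open>A * G * ?B = A\<close>.\<close>
  have "?B * (G * ?B - 1\<^sub>m n) = ?B * G * ?B - ?B"
    using d by (simp add: mat_algebra)
  then have 0: "?B * (G * ?B - 1\<^sub>m n) = 0\<^sub>m n n"
    using A by (simp add: BGB)
  have "G * ?B - 1\<^sub>m n \<in> carrier_mat n n"
    using d by (intro carrier_matI) simp_all
  from gram_mult_eq_0_imp[OF A this 0] have AGB: "A * G * ?B - A = 0\<^sub>m m n"
    using d by (simp add: mat_algebra)
  have AGB: "A * G * ?B = A"
  proof (rule eq_matI)
    fix i j assume "i < dim_row A" "j < dim_col A"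
    then have "(A * G * ?B - A) $$ (i, j) = 0" using A AGB by simp
    then show "(A * G * ?B) $$ (i, j) = A $$ (i, j)"
      using \<open>i < dim_row A\<close> \<open>j < dim_col A\<close> by simp
  qed (use A in auto)
  have "transpose_mat A = transpose_mat (A * G * ?B)" by (simp add: AGB)
  then have tA: "?B * transpose_mat G * transpose_mat A = transpose_mat A"
    using d by (simp add: mat_algebra)
  \<comment> \<open>Symmetry: inserting the transposed identity \<open>tA\<close> turns A G A^T into
    A G^T A^T, which is its transpose.\<close>
  have "A * (G * transpose_mat A) = A * G * (?B * transpose_mat G * transpose_mat A)"
    unfolding tA using d by (simp add: mat_algebra)
  also have "\<dots> = (A * G * ?B) * transpose_mat G * transpose_mat A"
    using d by (simp add: mat_algebra)
  also have "\<dots> = A * transpose_mat G * transpose_mat A" by (simp add: AGB)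
  finally have "transpose_mat (A * (G * transpose_mat A)) = A * (G * transpose_mat A)"
    using d by (simp add: mat_algebra)
  moreover have "A * (G * transpose_mat A) * A = A"
    using AGB d by (simp add: mat_algebra)
  ultimately show ?thesis using A G by (intro bexI[of _ "G * transpose_mat A"]) auto
qed

section \<open>Existence and uniqueness of the Moore-Penrose inverse\<close>

definition penrose :: "real mat \<Rightarrow> real mat \<Rightarrow> bool" where
  "penrose A X \<longleftrightarrow> X \<in> carrier_mat (dim_col A) (dim_row A) \<and>
      A * X * A = A \<and> X * A * X = X \<and>
      transpose_mat (A * X) = A * X \<and> transpose_mat (X * A) = X * A"

text \<open>If \<open>X\<close> and \<open>Y\<close> are generalized inverses of \<open>A\<close>
  with \<open>A * X\<close> and \<open>Y * A\<close> symmetric, then \<open>Y * A * X\<close> meets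
  all four conditions.\<close>

lemma penrose_exists: "\<exists>X. penrose A X"
proof -
  obtain X where X: "X \<in> carrier_mat (dim_col A) (dim_row A)"
    and AXA: "A * X * A = A" and AX: "transpose_mat (A * X) = A * X"
    using least_squares_inverse_exists[of A "dim_row A" "dim_col A"] by auto
  obtain Z where Z: "Z \<in> carrier_mat (dim_row A) (dim_col A)"
    and AZA: "transpose_mat A * Z * transpose_mat A = transpose_mat A"
    and AZ: "transpose_mat (transpose_mat A * Z) = transpose_mat A * Z"
    using least_squares_inverse_exists[of "transpose_mat A" "dim_col A" "dim_row A"] by auto
  \<comment> \<open>A least squares inverse of the transpose, transposed back, has its symmetric
    product on the other side.\<close>
  define Y where "Y = transpose_mat Z"
  have Y: "Y \<in> carrier_mat (dim_col A) (dim_row A)" using Z by (simp add: Y_def)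
  note d = carrier_matD[OF X] carrier_matD[OF Y] carrier_matD[OF Z]
  have YA: "transpose_mat (Y * A) = Y * A"
    using AZ d by (simp add: Y_def mat_algebra)
  have "transpose_mat (transpose_mat A * Z * transpose_mat A) = transpose_mat (transpose_mat A)"
    by (simp only: AZA)
  then have AYA: "A * Y * A = A" using d by (simp add: Y_def mat_algebra)
  have 1: "A * (Y * A * X) = A * X" using AYA d by (metis mat_mult_assoc index_mult_mat(2,3))
  have 2: "Y * A * X * A = Y * A" using AXA d by (metis mat_mult_assoc index_mult_mat(2,3))
  have "penrose A (Y * A * X)"
    unfolding penrose_def 1 2
  proof (intro conjI)
    show "Y * A * X \<in> carrier_mat (dim_col A) (dim_row A)" using d by (intro carrier_matI) simp_all
    show "A * X * A = A" "transpose_mat (A * X) = A * X" "transpose_mat (Y * A) = Y * A"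
      by fact+
    show "Y * A * (Y * A * X) = Y * A * X"
      using AYA d by (metis mat_mult_assoc index_mult_mat(2,3))
  qed
  then show ?thesis by blast
qed

text \<open>\<open>A * X\<close> and \<open>A * Y\<close> are symmetric and absorb each other, so
  transposition identifies them; likewise \<open>X * A\<close> and \<open>Y * A\<close>. Then X = X
  A X = Y A Y = Y.\<close>

lemma penrose_unique:
  assumes X: "penrose A X" and Y: "penrose A Y"
  shows "X = Y"
proof -
  have d: "dim_row X = dim_col A" "dim_col X = dim_row A" "dim_row Y = dim_col A" "dim_col Y = dim_row A"
    using X Y by (auto simp: penrose_def)
  have AXA: "A * X * A = A" and AYA: "A * Y * A = A" and XAX: "X * A * X = X" and YAY: "Y * A * Y = Y"
    and sX: "transpose_mat (A * X) = A * X" "transpose_mat (X * A) = X * A"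
    and sY: "transpose_mat (A * Y) = A * Y" "transpose_mat (Y * A) = Y * A"
    using X Y by (auto simp: penrose_def)
  have "A * X = (A * Y) * (A * X)" using AYA d by (metis mat_mult_assoc index_mult_mat(2,3))
  also have "\<dots> = transpose_mat (A * Y) * transpose_mat (A * X)" by (simp only: sX sY)
  also have "\<dots> = transpose_mat (A * X * (A * Y))" using d by (subst mat_transpose_mult) auto
  also have "A * X * (A * Y) = A * Y" using AXA d by (metis mat_mult_assoc index_mult_mat(2,3))
  finally have AX: "A * X = A * Y" by (simp only: sY)
  have "X * A = (X * A) * (Y * A)" using AYA d by (metis mat_mult_assoc index_mult_mat(2,3))
  also have "\<dots> = transpose_mat (X * A) * transpose_mat (Y * A)" by (simp only: sX sY)
  also have "\<dots> = transpose_mat (Y * A * (X * A))" using d by (subst mat_transpose_mult) auto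
  also have "Y * A * (X * A) = Y * A" using AXA d by (metis mat_mult_assoc index_mult_mat(2,3))
  finally have XA: "X * A = Y * A" by (simp only: sY)
  have "X = X * A * X" by (simp add: XAX)
  also have "\<dots> = Y * (A * X)" unfolding XA using d by (simp add: mat_mult_assoc)
  also have "\<dots> = Y" unfolding AX using d YAY by (simp add: mat_mult_assoc)
  finally show ?thesis .
qed

lemma penrose_mp_inverse: "penrose A (mp_inverse A)"
proof -
  have "mp_inverse A = (THE X. penrose A X)"
    by (simp add: mp_inverse_def penrose_def)
  then show ?thesis
    using penrose_exists[of A] penrose_unique[of A] theI[of "penrose A"] by metis
qed

lemma mp_inverse_dim [simp]:
  "dim_row (mp_inverse A) = dim_col A" "dim_col (mp_inverse A) = dim_row A"
  using penrose_mp_inverse[of A] by (auto simp: penrose_def)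

lemma mp_inverse:
  "A * mp_inverse A * A = A" "mp_inverse A * A * mp_inverse A = mp_inverse A"
  "transpose_mat (A * mp_inverse A) = A * mp_inverse A"
  "transpose_mat (mp_inverse A * A) = mp_inverse A * A"
  using penrose_mp_inverse[of A] by (auto simp: penrose_def)

section \<open>Spectral radius of nonnegative matrices\<close>

lemma nonneg_mat_iff:
  "nonneg_mat M \<longleftrightarrow> (\<forall>i<dim_row M. \<forall>j<dim_col M. 0 \<le> M $$ (i, j))"
  by (auto simp: nonneg_mat_def less_eq_mat_def)

lemma nonneg_mat_transpose: "nonneg_mat M \<Longrightarrow> nonneg_mat (transpose_mat M)"
  by (auto simp: nonneg_mat_iff)

lemma index_mult_mat_vec_sum:
  assumes "i < dim_row M" "dim_vec v = dim_col M"
  shows "(M *\<^sub>v v) $ i = (\<Sum>j<dim_col M. M $$ (i, j) * v $ j)"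
  using assms by (simp add: scalar_prod_def atLeast0LessThan)

lemma mult_mat_vec_mono:
  fixes M :: "real mat"
  assumes "nonneg_mat M" "u \<le> v" "dim_vec v = dim_col M"
  shows "M *\<^sub>v u \<le> M *\<^sub>v v"
  using assms
  by (auto simp: less_eq_vec_def nonneg_mat_iff scalar_prod_def intro!: sum_mono mult_left_mono)

lemma mult_mat_vec_mono_left:
  fixes M N :: "real mat"
  assumes "M \<le> N" "0\<^sub>v (dim_col N) \<le> v"
  shows "M *\<^sub>v v \<le> N *\<^sub>v v"
  using assms
  by (auto simp: less_eq_vec_def less_eq_mat_def scalar_prod_def intro!: sum_mono mult_right_mono)

lemma smult_mat_mult_vec:
  fixes M :: "'a :: comm_semiring_0 mat"
  assumes "dim_vec v = dim_col M"
  shows "(c \<cdot>\<^sub>m M) *\<^sub>v v = c \<cdot>\<^sub>v (M *\<^sub>v v)"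
  using assms
  by (intro eq_vecI) (simp_all add: scalar_prod_def sum_distrib_left mult.assoc)

lemma smult_vec_mono:
  fixes u v :: "real vec"
  assumes "0 \<le> c" "u \<le> v"
  shows "c \<cdot>\<^sub>v u \<le> c \<cdot>\<^sub>v v"
  using assms by (auto simp: less_eq_vec_def intro: mult_left_mono)

lemma rspectral_radius_eigenvalue:
  assumes "M \<in> carrier_mat n n" "0 < n"
  obtains c v where "v \<in> carrier_vec n" "v \<noteq> 0\<^sub>v n"
    "map_mat complex_of_real M *\<^sub>v v = c \<cdot>\<^sub>v v" "cmod c = rspectral_radius M"
proof -
  let ?C = "map_mat complex_of_real M"
  have C: "?C \<in> carrier_mat n n" using assms by simp
  obtain c where c: "eigenvalue ?C c" "cmod c = rspectral_radius M"
    using spectral_radius_mem_max(1)[OF C assms(2)]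
    by (auto simp: rspectral_radius_def spectrum_def)
  then show thesis
    using that C by (auto simp: eigenvalue_def eigenvector_def)
qed

lemma norm_eigenvalue_le_rspectral_radius:
  assumes "M \<in> carrier_mat n n" "0 < n" "v \<in> carrier_vec n" "v \<noteq> 0\<^sub>v n"
    "map_mat complex_of_real M *\<^sub>v v = c \<cdot>\<^sub>v v"
  shows "cmod c \<le> rspectral_radius M"
proof -
  let ?C = "map_mat complex_of_real M"
  have C: "?C \<in> carrier_mat n n" using assms by simp
  have "eigenvalue ?C c"
    using assms by (auto simp: eigenvalue_def eigenvector_def)
  then show ?thesis
    using spectral_radius_mem_max(2)[OF C assms(2)]
    by (auto simp: rspectral_radius_def spectrum_def)
qed

lemma rspectral_radius_nonneg:
  assumes "M \<in> carrier_mat n n" "0 < n"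
  shows "0 \<le> rspectral_radius M"
  using rspectral_radius_eigenvalue[OF assms] by (metis norm_ge_zero)

text \<open>The characteristic polynomial, whose roots form the spectrum, is the same for the
  transpose.\<close>

lemma rspectral_radius_transpose:
  assumes "M \<in> carrier_mat n n"
  shows "rspectral_radius (transpose_mat M) = rspectral_radius M"
proof -
  let ?C = "map_mat complex_of_real M"
  have C: "?C \<in> carrier_mat n n" using assms by simp
  have eq: "map_mat complex_of_real (transpose_mat M) = transpose_mat ?C"
    by (rule eq_matI) auto
  have "spectrum (transpose_mat ?C) = spectrum ?C"
    using spectrum_root_char_poly[OF C] spectrum_root_char_poly[of "transpose_mat ?C" n] C
    by simp
  then show ?thesis by (simp add: rspectral_radius_def spectral_radius_def eq)
qed

text \<open>The entrywise moduli of an eigenvector for an eigenvalue of maximal modulus; this replaces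
  the Perron--Frobenius theorem.\<close>

lemma nonneg_mat_subinvariant_vec:
  assumes M: "M \<in> carrier_mat n n" and "0 < n" and nn: "nonneg_mat M"
  obtains z where "z \<in> carrier_vec n" "0\<^sub>v n \<le> z" "z \<noteq> 0\<^sub>v n"
    "rspectral_radius M \<cdot>\<^sub>v z \<le> M *\<^sub>v z"
proof -
  obtain c v where v: "v \<in> carrier_vec n" "v \<noteq> 0\<^sub>v n"
    and ev: "map_mat complex_of_real M *\<^sub>v v = c \<cdot>\<^sub>v v" and c: "cmod c = rspectral_radius M"
    using rspectral_radius_eigenvalue[OF M \<open>0 < n\<close>] by metis
  define z where "z = map_vec cmod v"
  have z: "z \<in> carrier_vec n" using v by (simp add: z_def)
  have "z \<noteq> 0\<^sub>v n"
  proof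
    assume eq: "z = 0\<^sub>v n"
    have "v = 0\<^sub>v n"
    proof (rule eq_vecI)
      fix i assume i: "i < dim_vec (0\<^sub>v n :: complex vec)"
      then have "z $ i = 0" by (simp add: eq)
      then show "v $ i = 0\<^sub>v n $ i" using i v by (simp add: z_def)
    qed (use v in simp)
    with v show False by simp
  qed
  moreover have "rspectral_radius M \<cdot>\<^sub>v z \<le> M *\<^sub>v z"
    unfolding less_eq_vec_def
  proof (intro conjI allI impI)
    fix i assume "i < dim_vec (M *\<^sub>v z)"
    then have i: "i < n" using M by simp
    have "(rspectral_radius M \<cdot>\<^sub>v z) $ i = cmod ((c \<cdot>\<^sub>v v) $ i)"
      using i v by (simp add: z_def norm_mult c)
    also have "\<dots> = cmod (\<Sum>j<n. complex_of_real (M $$ (i, j)) * v $ j)"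
      unfolding ev[symmetric] using i v M by (subst index_mult_mat_vec_sum) auto
    also have "\<dots> \<le> (\<Sum>j<n. cmod (complex_of_real (M $$ (i, j)) * v $ j))"
      by (rule norm_sum)
    also have "\<dots> = (\<Sum>j<n. M $$ (i, j) * z $ j)"
      using i v M nn by (intro sum.cong) (auto simp: norm_mult z_def nonneg_mat_iff)
    also have "\<dots> = (M *\<^sub>v z) $ i"
      using i z M by (subst index_mult_mat_vec_sum) auto
    finally show "(rspectral_radius M \<cdot>\<^sub>v z) $ i \<le> (M *\<^sub>v z) $ i" .
  qed (use M z in auto)
  moreover have "0\<^sub>v n \<le> z" using v by (simp add: less_eq_vec_def z_def)
  ultimately show thesis using that z by blast
qed

section \<open>Lower bounds on the spectral radius from subinvariant vectors\<close>

text \<open>A nonnegative \<open>M\<close> preserves the order of vectors, so the hypothesis passes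
  from \<open>z\<close> to \<open>M *\<^sub>v z\<close>; the induction therefore generalizes over
  \<open>z\<close>.\<close>

lemma smult_le_pow_mult_mat_vec:
  fixes M :: "real mat"
  assumes M: "M \<in> carrier_mat n n" and nn: "nonneg_mat M" and z: "z \<in> carrier_vec n"
    and "0 \<le> q" and le: "q \<cdot>\<^sub>v z \<le> M *\<^sub>v z"
  shows "q ^ k \<cdot>\<^sub>v z \<le> (M ^\<^sub>m k) *\<^sub>v z"
  using z le
proof (induction k arbitrary: z)
  case 0
  then show ?case using M by simp
next
  case (Suc k)
  have Mz: "M *\<^sub>v z \<in> carrier_vec n" using M Suc.prems(1) by simp
  have "q \<cdot>\<^sub>v (M *\<^sub>v z) = M *\<^sub>v (q \<cdot>\<^sub>v z)"
    using M Suc.prems(1) by (simp add: mult_mat_vec)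
  also have "\<dots> \<le> M *\<^sub>v (M *\<^sub>v z)"
    using M by (intro mult_mat_vec_mono nn Suc.prems(2)) simp
  finally have IH: "q ^ k \<cdot>\<^sub>v (M *\<^sub>v z) \<le> (M ^\<^sub>m k) *\<^sub>v (M *\<^sub>v z)"
    by (intro Suc.IH Mz)
  have "q ^ Suc k \<cdot>\<^sub>v z = q ^ k \<cdot>\<^sub>v (q \<cdot>\<^sub>v z)"
    by (simp add: smult_smult_assoc mult.commute)
  also have "\<dots> \<le> q ^ k \<cdot>\<^sub>v (M *\<^sub>v z)"
    using \<open>0 \<le> q\<close> by (intro smult_vec_mono Suc.prems(2)) simp
  also note IH
  also have "(M ^\<^sub>m k) *\<^sub>v (M *\<^sub>v z) = (M ^\<^sub>m Suc k) *\<^sub>v z"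
    using M Suc.prems(1) by (simp add: assoc_mult_mat_vec[of _ n n _ n])
  finally show ?case .
qed

text \<open>Were the radius below 1, the powers of \<open>M\<close> would be bounded entrywise,
  while M^k z >= q^k z grows without bound in a positive coordinate of \<open>z\<close>.\<close>

lemma one_le_rspectral_radius:
  assumes M: "M \<in> carrier_mat n n" and nn: "nonneg_mat M"
    and z: "z \<in> carrier_vec n" "0\<^sub>v n \<le> z" "z \<noteq> 0\<^sub>v n"
    and "1 < q" and le: "q \<cdot>\<^sub>v z \<le> M *\<^sub>v z"
  shows "1 \<le> rspectral_radius M"
proof (rule ccontr)
  assume "\<not> 1 \<le> rspectral_radius M"
  then have "spectral_radius (map_mat complex_of_real M) < 1"
    by (simp add: rspectral_radius_def)
  moreover have C: "map_mat complex_of_real M \<in> carrier_mat n n" using M by simp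
  ultimately obtain b where b: "\<And>k. norm_bound (map_mat complex_of_real M ^\<^sub>m k) b"
    using spectral_radius_jnf_norm_bound_less_1_upper_triangular by blast
  have bound: "(M ^\<^sub>m k) $$ (i, j) \<le> b" if "i < n" "j < n" for i j k
  proof -
    have Mk: "M ^\<^sub>m k \<in> carrier_mat n n" using M by simp
    have "cmod (complex_of_real ((M ^\<^sub>m k) $$ (i, j))) \<le> b"
      using b[of k] that Mk
      unfolding of_real_hom.mat_hom_pow[OF M, symmetric] norm_bound_def
      by (metis carrier_matD index_map_mat)
    then show ?thesis by (simp add: abs_le_iff)
  qed
  obtain i where i: "i < n" "0 < z $ i"
  proof -
    obtain i where "i < n" "z $ i \<noteq> 0" using z by (metis eq_vecI carrier_vecD index_zero_vec)
    moreover have "0 \<le> z $ i" using z(1,2) \<open>i < n\<close> by (auto simp: less_eq_vec_def)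
    ultimately show thesis using that by simp
  qed
  \<comment> \<open>A bound, independent of \<open>k\<close>, for every coordinate of M^k z.\<close>
  define s where "s = (\<Sum>j<n. b * z $ j)"
  have "q ^ k * z $ i \<le> s" for k
  proof -
    have Mk: "M ^\<^sub>m k \<in> carrier_mat n n" using M by simp
    have "q ^ k \<cdot>\<^sub>v z \<le> (M ^\<^sub>m k) *\<^sub>v z"
      using \<open>1 < q\<close> by (intro smult_le_pow_mult_mat_vec[OF M nn z(1) _ le]) simp
    then have "q ^ k * z $ i \<le> ((M ^\<^sub>m k) *\<^sub>v z) $ i"
      using Mk z i by (auto simp: less_eq_vec_def)
    also have "\<dots> = (\<Sum>j<n. (M ^\<^sub>m k) $$ (i, j) * z $ j)"
      using Mk z i by (subst index_mult_mat_vec_sum) auto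
    also have "\<dots> \<le> s"
      unfolding s_def using bound i z
      by (intro sum_mono mult_right_mono) (auto simp: less_eq_vec_def)
    finally show ?thesis .
  qed
  moreover obtain k where "s / z $ i < q ^ k"
    using real_arch_pow[OF \<open>1 < q\<close>] by blast
  ultimately show False
    using i by (metis not_less pos_divide_less_eq)
qed

text \<open>Reduction to the threshold 1 by rescaling with some \<open>r\<close> strictly between
  the radius and \<open>q\<close>.\<close>

lemma le_rspectral_radius:
  assumes M: "M \<in> carrier_mat n n" and nn: "nonneg_mat M"
    and z: "z \<in> carrier_vec n" "0\<^sub>v n \<le> z" "z \<noteq> 0\<^sub>v n"
    and le: "q \<cdot>\<^sub>v z \<le> M *\<^sub>v z"
  shows "q \<le> rspectral_radius M"
proof (rule ccontr)
  assume "\<not> q \<le> rspectral_radius M"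
  then obtain r where r: "rspectral_radius M < r" "r < q"
    using dense by (metis not_le)
  have n: "0 < n" using z by (cases n) auto
  have "0 < r" using r rspectral_radius_nonneg[OF M n] by simp
  define N where "N = (1 / r) \<cdot>\<^sub>m M"
  have N: "N \<in> carrier_mat n n" using M by (simp add: N_def)
  have "1 \<le> rspectral_radius N"
  proof (rule one_le_rspectral_radius[OF N _ z])
    show "nonneg_mat N" using nn \<open>0 < r\<close> by (auto simp: nonneg_mat_iff N_def)
    show "1 < q / r" using r \<open>0 < r\<close> by simp
    have "(1 / r) \<cdot>\<^sub>v (q \<cdot>\<^sub>v z) \<le> (1 / r) \<cdot>\<^sub>v (M *\<^sub>v z)"
      using \<open>0 < r\<close> by (intro smult_vec_mono le) simp
    then show "(q / r) \<cdot>\<^sub>v z \<le> N *\<^sub>v z"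
      using M z by (simp add: N_def smult_smult_assoc smult_mat_mult_vec)
  qed
  \<comment> \<open>An eigenvalue \<open>c\<close> of \<open>N\<close> of maximal modulus gives the
    eigenvalue \<open>r * c\<close> of \<open>M\<close>, so the radius of \<open>M\<close> is at
    least \<open>r\<close>, against the choice of \<open>r\<close>.\<close>
  obtain c v where v: "v \<in> carrier_vec n" "v \<noteq> 0\<^sub>v n"
    and ev: "map_mat complex_of_real N *\<^sub>v v = c \<cdot>\<^sub>v v" and c: "cmod c = rspectral_radius N"
    using rspectral_radius_eigenvalue[OF N n] by metis
  have "map_mat complex_of_real M = complex_of_real r \<cdot>\<^sub>m map_mat complex_of_real N"
    using \<open>0 < r\<close> by (intro eq_matI) (auto simp: N_def)
  then have "map_mat complex_of_real M *\<^sub>v v = complex_of_real r \<cdot>\<^sub>v (c \<cdot>\<^sub>v v)"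
    using N v by (simp add: smult_mat_mult_vec ev[symmetric])
  then have "cmod (complex_of_real r * c) \<le> rspectral_radius M"
    using norm_eigenvalue_le_rspectral_radius[OF M n v] by (simp add: smult_smult_assoc)
  then have "r * rspectral_radius N \<le> rspectral_radius M"
    using \<open>0 < r\<close> by (simp add: norm_mult c)
  moreover have "r * 1 \<le> r * rspectral_radius N"
    using \<open>1 \<le> rspectral_radius N\<close> \<open>0 < r\<close> by (intro mult_left_mono) auto
  ultimately show False using r by simp
qed

section \<open>Block companion matrices\<close>

lemma transpose_mat_mono:
  fixes M N :: "real mat"
  shows "M \<le> N \<Longrightarrow> transpose_mat M \<le> transpose_mat N"
  by (auto simp: less_eq_mat_def)

text \<open>Linearization of a quadratic pencil: t is an eigenvalue iff t^2 x = t X x + Y x for some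
  nonzero x. \<open>iter_mat\<close> has this form.\<close>

abbreviation companion_mat :: "nat \<Rightarrow> real mat \<Rightarrow> real mat \<Rightarrow> real mat" where
  "companion_mat n X Y \<equiv> four_block_mat X Y (1\<^sub>m n) (0\<^sub>m n n)"

lemma transpose_companion_mult_vec:
  assumes X: "X \<in> carrier_mat n n" and Y: "Y \<in> carrier_mat n n"
    and u: "u \<in> carrier_vec n" and v: "v \<in> carrier_vec n"
  shows "transpose_mat (companion_mat n X Y) *\<^sub>v (u @\<^sub>v v)
    = (transpose_mat X *\<^sub>v u + v) @\<^sub>v (transpose_mat Y *\<^sub>v u)"
proof -
  have "transpose_mat (companion_mat n X Y)
      = four_block_mat (transpose_mat X) (1\<^sub>m n) (transpose_mat Y) (0\<^sub>m n n)"
    by (subst transpose_four_block_mat[OF X Y]) auto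
  also have "\<dots> *\<^sub>v (u @\<^sub>v v)
      = (transpose_mat X *\<^sub>v u + 1\<^sub>m n *\<^sub>v v) @\<^sub>v (transpose_mat Y *\<^sub>v u + 0\<^sub>m n n *\<^sub>v v)"
    using X Y u v by (intro four_block_mat_mult_vec) auto
  also have "1\<^sub>m n *\<^sub>v v = v" using v by simp
  also have "transpose_mat Y *\<^sub>v u + 0\<^sub>m n n *\<^sub>v v = transpose_mat Y *\<^sub>v u"
    using Y u v by (intro eq_vecI) auto
  finally show ?thesis .
qed

lemma transpose_pencil_mult_vec:
  fixes X Y :: "real mat"
  assumes X: "X \<in> carrier_mat n n" and Y: "Y \<in> carrier_mat n n" and u: "u \<in> carrier_vec n"
  shows "transpose_mat (r \<cdot>\<^sub>m X + Y) *\<^sub>v u = r \<cdot>\<^sub>v (transpose_mat X *\<^sub>v u) + transpose_mat Y *\<^sub>v u"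
proof -
  have "transpose_mat (r \<cdot>\<^sub>m X + Y) = r \<cdot>\<^sub>m transpose_mat X + transpose_mat Y"
    using X Y by (intro eq_matI) auto
  moreover have "(r \<cdot>\<^sub>m transpose_mat X + transpose_mat Y) *\<^sub>v u
      = (r \<cdot>\<^sub>m transpose_mat X) *\<^sub>v u + transpose_mat Y *\<^sub>v u"
    using X Y u by (intro add_mult_distrib_mat_vec) auto
  ultimately show ?thesis
    using X u by (simp add: smult_mat_mult_vec)
qed

lemma companion_carrier:
  "X \<in> carrier_mat n n \<Longrightarrow> companion_mat n X Y \<in> carrier_mat (n + n) (n + n)"
  by simp

lemma nonneg_companion:
  assumes "X \<in> carrier_mat n n" "Y \<in> carrier_mat n n" "nonneg_mat X" "nonneg_mat Y"
  shows "nonneg_mat (companion_mat n X Y)"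
  using assms by (auto simp: nonneg_mat_iff)

text \<open>A subinvariant vector (u, v) of the transpose satisfies r u <= X^T u + v and r v <= Y^T
  u; eliminating \<open>v\<close> gives the claim. The transpose is taken because
  \<open>X + Y\<close> will factor as \<open>B * Z\<close>, and the convergence argument ends in u^T
  B = 0.\<close>

lemma companion_subinvariant_vec:
  assumes X: "X \<in> carrier_mat n n" and Y: "Y \<in> carrier_mat n n"
    and nn: "nonneg_mat X" "nonneg_mat Y" and "0 < n"
    and r: "r = rspectral_radius (companion_mat n X Y)" "0 < r"
  obtains u where "u \<in> carrier_vec n" "0\<^sub>v n \<le> u" "u \<noteq> 0\<^sub>v n"
    "r\<^sup>2 \<cdot>\<^sub>v u \<le> transpose_mat (r \<cdot>\<^sub>m X + Y) *\<^sub>v u"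
proof -
  let ?W = "companion_mat n X Y"
  have W: "?W \<in> carrier_mat (n + n) (n + n)" by (rule companion_carrier[OF X])
  have Wt: "transpose_mat ?W \<in> carrier_mat (n + n) (n + n)" using W by simp
  have n2: "0 < n + n" using \<open>0 < n\<close> by simp
  obtain z where z: "z \<in> carrier_vec (n + n)" "0\<^sub>v (n + n) \<le> z" "z \<noteq> 0\<^sub>v (n + n)"
    and le: "r \<cdot>\<^sub>v z \<le> transpose_mat ?W *\<^sub>v z"
    by (rule nonneg_mat_subinvariant_vec[OF Wt n2 nonneg_mat_transpose[OF nonneg_companion[OF X Y nn]],
      unfolded rspectral_radius_transpose[OF W] r(1)[symmetric]])
  define u v where "u = vec_first z n" and "v = vec_last z n"
  have u: "u \<in> carrier_vec n" and v: "v \<in> carrier_vec n" by (auto simp: u_def v_def)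
  have zuv: "z = u @\<^sub>v v" using z(1) by (simp add: u_def v_def)
  have rz: "r \<cdot>\<^sub>v z = (r \<cdot>\<^sub>v u) @\<^sub>v (r \<cdot>\<^sub>v v)" unfolding zuv by (intro eq_vecI) auto
  have "r \<cdot>\<^sub>v u \<le> transpose_mat X *\<^sub>v u + v \<and> r \<cdot>\<^sub>v v \<le> transpose_mat Y *\<^sub>v u"
    using le unfolding rz unfolding zuv transpose_companion_mult_vec[OF X Y u v]
    using X Y u v by (subst (asm) append_vec_le[of _ n]) auto
  then have le1: "r \<cdot>\<^sub>v u \<le> transpose_mat X *\<^sub>v u + v" and le2: "r \<cdot>\<^sub>v v \<le> transpose_mat Y *\<^sub>v u"
    by auto
  have "0\<^sub>v (n + n) = 0\<^sub>v n @\<^sub>v (0\<^sub>v n :: real vec)" by (intro eq_vecI) auto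
  then have "0\<^sub>v n @\<^sub>v 0\<^sub>v n \<le> u @\<^sub>v v" using z(2) zuv by simp
  then have u0: "0\<^sub>v n \<le> u" and v0: "0\<^sub>v n \<le> v"
    using u by (auto simp: append_vec_le[of _ n])
  \<comment> \<open>If \<open>u\<close> vanished, r v <= 0 together with v >= 0 and r > 0 would make
    \<open>v\<close> vanish too.\<close>
  have "u \<noteq> 0\<^sub>v n"
  proof
    assume eq: "u = 0\<^sub>v n"
    have "v $ i = 0" if "i < n" for i
    proof -
      have "r * v $ i \<le> 0"
        using le2 that v Y unfolding eq less_eq_vec_def by simp
      then show ?thesis
        using v0 v that \<open>0 < r\<close> by (auto simp: less_eq_vec_def mult_le_0_iff)
    qed
    then have "z = 0\<^sub>v (n + n)" using u v eq unfolding zuv by (intro eq_vecI) auto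
    with z show False by simp
  qed
  moreover have "r\<^sup>2 \<cdot>\<^sub>v u \<le> transpose_mat (r \<cdot>\<^sub>m X + Y) *\<^sub>v u"
    unfolding transpose_pencil_mult_vec[OF X Y u] less_eq_vec_def
  proof (intro conjI allI impI)
    fix i assume "i < dim_vec (r \<cdot>\<^sub>v (transpose_mat X *\<^sub>v u) + transpose_mat Y *\<^sub>v u)"
    then have i: "i < n" using Y by simp
    have "r * u $ i \<le> (transpose_mat X *\<^sub>v u) $ i + v $ i"
      using le1 i u v X by (auto simp: less_eq_vec_def)
    then have "r * (r * u $ i) \<le> r * ((transpose_mat X *\<^sub>v u) $ i + v $ i)"
      using \<open>0 < r\<close> by (intro mult_left_mono) auto
    also have "r * v $ i \<le> (transpose_mat Y *\<^sub>v u) $ i"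
      using le2 i u v Y by (auto simp: less_eq_vec_def)
    ultimately have "r * (r * u $ i) \<le> r * (transpose_mat X *\<^sub>v u) $ i + (transpose_mat Y *\<^sub>v u) $ i"
      unfolding distrib_left by linarith
    then show "(r\<^sup>2 \<cdot>\<^sub>v u) $ i \<le> (r \<cdot>\<^sub>v (transpose_mat X *\<^sub>v u) + transpose_mat Y *\<^sub>v u) $ i"
      using i u X Y by (simp add: power2_eq_square mult.assoc)
  qed (use u X Y in auto)
  ultimately show thesis using that u u0 by blast
qed

text \<open>Converse of \<open>companion_subinvariant_vec\<close>: \<open>v\<close> is chosen to
  make the lower block inequality an equality, and the upper one is then the hypothesis divided by
  \<open>r\<close>.\<close>

lemma le_rspectral_radius_companion:
  assumes X: "X \<in> carrier_mat n n" and Y: "Y \<in> carrier_mat n n"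
    and nn: "nonneg_mat X" "nonneg_mat Y"
    and u: "u \<in> carrier_vec n" "0\<^sub>v n \<le> u" "u \<noteq> 0\<^sub>v n" and "0 < r"
    and le: "r\<^sup>2 \<cdot>\<^sub>v u \<le> transpose_mat (r \<cdot>\<^sub>m X + Y) *\<^sub>v u"
  shows "r \<le> rspectral_radius (companion_mat n X Y)"
proof -
  let ?W = "companion_mat n X Y"
  have W: "?W \<in> carrier_mat (n + n) (n + n)" by (rule companion_carrier[OF X])
  have Wt: "transpose_mat ?W \<in> carrier_mat (n + n) (n + n)" using W by simp
  define v where "v = (1 / r) \<cdot>\<^sub>v (transpose_mat Y *\<^sub>v u)"
  have v: "v \<in> carrier_vec n" using Y by (intro carrier_vecI) (simp add: v_def)
  have "transpose_mat Y *\<^sub>v 0\<^sub>v n \<le> transpose_mat Y *\<^sub>v u"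
    using Y u by (intro mult_mat_vec_mono nonneg_mat_transpose nn) auto
  moreover have "transpose_mat Y *\<^sub>v 0\<^sub>v n = 0\<^sub>v n" using Y by (intro eq_vecI) auto
  ultimately have v0: "0\<^sub>v n \<le> v"
    using \<open>0 < r\<close> Y by (auto simp: v_def less_eq_vec_def)
  have "r \<le> rspectral_radius (transpose_mat ?W)"
  proof (rule le_rspectral_radius[OF Wt])
    show "nonneg_mat (transpose_mat ?W)"
      by (intro nonneg_mat_transpose nonneg_companion X Y nn)
    show "u @\<^sub>v v \<in> carrier_vec (n + n)" using u v by simp
    show "0\<^sub>v (n + n) \<le> u @\<^sub>v v" using u v v0 by (auto simp: less_eq_vec_def)
    show "u @\<^sub>v v \<noteq> 0\<^sub>v (n + n)"
    proof
      assume eq: "u @\<^sub>v v = 0\<^sub>v (n + n)"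
      have "u = 0\<^sub>v n"
      proof (rule eq_vecI)
        fix i assume "i < dim_vec (0\<^sub>v n :: real vec)"
        then have i: "i < n" by simp
        then have "(u @\<^sub>v v) $ i = 0" unfolding eq by simp
        then show "u $ i = 0\<^sub>v n $ i" using i u v by simp
      qed (use u in simp)
      with u show False by simp
    qed
    have "r \<cdot>\<^sub>v u \<le> transpose_mat X *\<^sub>v u + v"
      unfolding less_eq_vec_def
    proof (intro conjI allI impI)
      fix i assume "i < dim_vec (transpose_mat X *\<^sub>v u + v)"
      then have i: "i < n" using v by simp
      have "r * (r * u $ i) \<le> r * (transpose_mat X *\<^sub>v u) $ i + (transpose_mat Y *\<^sub>v u) $ i"
        using le i u(1) X Y unfolding transpose_pencil_mult_vec[OF X Y u(1)]
        by (auto simp: less_eq_vec_def power2_eq_square mult.assoc)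
      also have "(transpose_mat Y *\<^sub>v u) $ i = r * v $ i"
        using i Y \<open>0 < r\<close> by (simp add: v_def)
      finally have "r * (r * u $ i) \<le> r * ((transpose_mat X *\<^sub>v u) $ i + v $ i)"
        by (simp add: distrib_left)
      then have "r * u $ i \<le> (transpose_mat X *\<^sub>v u) $ i + v $ i"
        using \<open>0 < r\<close> by (rule mult_left_le_imp_le)
      then show "(r \<cdot>\<^sub>v u) $ i \<le> (transpose_mat X *\<^sub>v u + v) $ i" using i u v X by simp
    qed (use u v in auto)
    moreover have "r \<cdot>\<^sub>v v = transpose_mat Y *\<^sub>v u"
      using \<open>0 < r\<close> by (simp add: v_def smult_smult_assoc)
    moreover have "r \<cdot>\<^sub>v (u @\<^sub>v v) = (r \<cdot>\<^sub>v u) @\<^sub>v (r \<cdot>\<^sub>v v)" by (intro eq_vecI) auto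
    ultimately show "r \<cdot>\<^sub>v (u @\<^sub>v v) \<le> transpose_mat ?W *\<^sub>v (u @\<^sub>v v)"
      unfolding transpose_companion_mult_vec[OF X Y u(1) v]
      using X u(1) v by (simp add: append_vec_le[of _ n])
  qed
  then show ?thesis by (simp add: rspectral_radius_transpose[OF W])
qed

section \<open>Comparison and convergence for companion matrices\<close>

text \<open>r X1 + Y1 = (X1 + Y1) - (1 - r) X1, and for r <= 1 both comparisons push this below r X2
  + Y2. A subinvariant vector for the first pencil thus serves for the second.\<close>

lemma rspectral_radius_companion_mono:
  assumes X1: "X1 \<in> carrier_mat n n" and Y1: "Y1 \<in> carrier_mat n n"
    and X2: "X2 \<in> carrier_mat n n" and Y2: "Y2 \<in> carrier_mat n n"
    and nn: "nonneg_mat X1" "nonneg_mat Y1" "nonneg_mat X2" "nonneg_mat Y2" and "0 < n"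
    and X: "X2 \<le> X1" and XY: "X1 + Y1 \<le> X2 + Y2"
    and le1: "rspectral_radius (companion_mat n X1 Y1) \<le> 1"
  shows "rspectral_radius (companion_mat n X1 Y1) \<le> rspectral_radius (companion_mat n X2 Y2)"
proof -
  define r where "r = rspectral_radius (companion_mat n X1 Y1)"
  have n2: "0 < n + n" using \<open>0 < n\<close> by simp
  show ?thesis
  proof (cases "0 < r")
    case True
    obtain u where u: "u \<in> carrier_vec n" "0\<^sub>v n \<le> u" "u \<noteq> 0\<^sub>v n"
      and le: "r\<^sup>2 \<cdot>\<^sub>v u \<le> transpose_mat (r \<cdot>\<^sub>m X1 + Y1) *\<^sub>v u"
      using companion_subinvariant_vec[OF X1 Y1 nn(1,2) \<open>0 < n\<close> r_def True] by metis
    have "r \<cdot>\<^sub>m X1 + Y1 \<le> r \<cdot>\<^sub>m X2 + Y2"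
      unfolding less_eq_mat_def
    proof (intro conjI allI impI)
      fix i j assume "i < dim_row (r \<cdot>\<^sub>m X2 + Y2)" "j < dim_col (r \<cdot>\<^sub>m X2 + Y2)"
      then have ij: "i < n" "j < n" using Y2 by auto
      have "X2 $$ (i, j) \<le> X1 $$ (i, j)"
        and "X1 $$ (i, j) + Y1 $$ (i, j) \<le> X2 $$ (i, j) + Y2 $$ (i, j)"
        using X XY X1 X2 Y1 Y2 ij by (auto simp: less_eq_mat_def)
      moreover have "(1 - r) * X2 $$ (i, j) \<le> (1 - r) * X1 $$ (i, j)"
        using le1 calculation by (intro mult_left_mono) (auto simp: r_def)
      ultimately have "r * X1 $$ (i, j) + Y1 $$ (i, j) \<le> r * X2 $$ (i, j) + Y2 $$ (i, j)"
        by (simp add: algebra_simps)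
      then show "(r \<cdot>\<^sub>m X1 + Y1) $$ (i, j) \<le> (r \<cdot>\<^sub>m X2 + Y2) $$ (i, j)"
        using ij X1 X2 Y1 Y2 by simp
    qed (use Y1 Y2 in auto)
    then have "transpose_mat (r \<cdot>\<^sub>m X1 + Y1) *\<^sub>v u \<le> transpose_mat (r \<cdot>\<^sub>m X2 + Y2) *\<^sub>v u"
      using u Y2 by (intro mult_mat_vec_mono_left transpose_mat_mono) auto
    with le have "r\<^sup>2 \<cdot>\<^sub>v u \<le> transpose_mat (r \<cdot>\<^sub>m X2 + Y2) *\<^sub>v u"
      by (rule order_trans)
    from le_rspectral_radius_companion[OF X2 Y2 nn(3,4) u True this]
    show ?thesis by (simp add: r_def)
  next
    \<comment> \<open>Here r <= 0, and the other radius is nonnegative.\<close>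
    case False
    then show ?thesis
      using rspectral_radius_nonneg[OF companion_carrier[OF X2] n2, of Y2] by (simp add: r_def)
  qed
qed

text \<open>From u^T H = u^T B + u^T T H >= u^T B + u^T H one gets u^T B <= 0, hence u^T B = 0 by
  signs. Then u^T T = u^T B Z = 0 and 0 <= u <= 0.\<close>

lemma subinvariant_vec_eq_0:
  fixes T B H Z :: "real mat"
  assumes T: "T \<in> carrier_mat n n" and B: "B \<in> carrier_mat n m" and H: "H \<in> carrier_mat n m"
    and Z: "Z \<in> carrier_mat m n"
    and nn: "nonneg_mat B" "nonneg_mat H"
    and HB: "H = B + T * H" and TB: "T = B * Z"
    and u: "u \<in> carrier_vec n" "0\<^sub>v n \<le> u" and le: "u \<le> transpose_mat T *\<^sub>v u"
  shows "u = 0\<^sub>v n"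
proof -
  have "transpose_mat (T * H) = transpose_mat H * transpose_mat T"
    using T H by (intro transpose_mult)
  then have "transpose_mat H = transpose_mat B + transpose_mat H * transpose_mat T"
    using B T H HB by (metis transpose_add mult_carrier_mat)
  then have "transpose_mat H *\<^sub>v u = (transpose_mat B + transpose_mat H * transpose_mat T) *\<^sub>v u"
    by simp
  also have "\<dots> = transpose_mat B *\<^sub>v u + (transpose_mat H * transpose_mat T) *\<^sub>v u"
    using B T H u by (intro add_mult_distrib_mat_vec) auto
  also have "(transpose_mat H * transpose_mat T) *\<^sub>v u = transpose_mat H *\<^sub>v (transpose_mat T *\<^sub>v u)"
    using T H u by (intro assoc_mult_mat_vec) auto
  finally have eq: "transpose_mat H *\<^sub>v u
      = transpose_mat B *\<^sub>v u + transpose_mat H *\<^sub>v (transpose_mat T *\<^sub>v u)" .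
  have mono: "transpose_mat H *\<^sub>v u \<le> transpose_mat H *\<^sub>v (transpose_mat T *\<^sub>v u)"
    using T H by (intro mult_mat_vec_mono nonneg_mat_transpose nn le) auto
  have "transpose_mat B *\<^sub>v 0\<^sub>v n \<le> transpose_mat B *\<^sub>v u"
    using B u by (intro mult_mat_vec_mono nonneg_mat_transpose nn) auto
  moreover have "transpose_mat B *\<^sub>v 0\<^sub>v n = 0\<^sub>v m" using B by (intro eq_vecI) auto
  ultimately have ge0: "0\<^sub>v m \<le> transpose_mat B *\<^sub>v u" by simp
  have Bu: "transpose_mat B *\<^sub>v u = 0\<^sub>v m"
  proof (rule eq_vecI)
    fix i assume "i < dim_vec (0\<^sub>v m :: real vec)"
    then have i: "i < m" by simp
    define h where "h = transpose_mat H *\<^sub>v u"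
    define g where "g = transpose_mat H *\<^sub>v (transpose_mat T *\<^sub>v u)"
    define b where "b = transpose_mat B *\<^sub>v u"
    have d: "dim_vec h = m" "dim_vec g = m" "dim_vec b = m"
      using H B by (simp_all add: h_def g_def b_def)
    have "h $ i = b $ i + g $ i" "h $ i \<le> g $ i" "0 \<le> b $ i"
      using i d eq mono ge0 unfolding h_def[symmetric] g_def[symmetric] b_def[symmetric]
      by (auto simp: less_eq_vec_def)
    then show "(transpose_mat B *\<^sub>v u) $ i = 0\<^sub>v m $ i"
      using i unfolding b_def[symmetric] by simp
  qed (use B in simp)
  have "transpose_mat T = transpose_mat Z * transpose_mat B"
    unfolding TB using B Z by (intro transpose_mult)
  then have "transpose_mat T *\<^sub>v u = transpose_mat Z *\<^sub>v (transpose_mat B *\<^sub>v u)"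
    using B Z u by (simp add: assoc_mult_mat_vec[of _ n m _ n])
  then have "transpose_mat T *\<^sub>v u = 0\<^sub>v n"
    unfolding Bu using Z by (auto intro!: eq_vecI)
  then show ?thesis using u le by simp
qed

text \<open>For a radius r >= 1, nonnegativity of \<open>Y\<close> puts the pencil below r (X + Y).
  This yields a nonzero u >= 0 with u <= (X + Y)^T u, which \<open>subinvariant_vec_eq_0\<close>
  excludes.\<close>

lemma rspectral_radius_companion_less_1:
  assumes X: "X \<in> carrier_mat n n" and Y: "Y \<in> carrier_mat n n"
    and nn: "nonneg_mat X" "nonneg_mat Y" and "0 < n"
    and B: "B \<in> carrier_mat n m" and H: "H \<in> carrier_mat n m" and Z: "Z \<in> carrier_mat m n"
    and nnB: "nonneg_mat B" "nonneg_mat H"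
    and HB: "H = B + (X + Y) * H" and TB: "X + Y = B * Z"
  shows "rspectral_radius (companion_mat n X Y) < 1"
proof (rule ccontr)
  define r where "r = rspectral_radius (companion_mat n X Y)"
  assume "\<not> rspectral_radius (companion_mat n X Y) < 1"
  then have r: "1 \<le> r" by (simp add: r_def)
  then have "0 < r" by simp
  obtain u where u: "u \<in> carrier_vec n" "0\<^sub>v n \<le> u" "u \<noteq> 0\<^sub>v n"
    and le: "r\<^sup>2 \<cdot>\<^sub>v u \<le> transpose_mat (r \<cdot>\<^sub>m X + Y) *\<^sub>v u"
    using companion_subinvariant_vec[OF X Y nn \<open>0 < n\<close> r_def \<open>0 < r\<close>] by metis
  have T: "X + Y \<in> carrier_mat n n" using X Y by simp
  have "r \<cdot>\<^sub>m X + Y \<le> r \<cdot>\<^sub>m (X + Y)"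
    unfolding less_eq_mat_def
  proof (intro conjI allI impI)
    fix i j assume "i < dim_row (r \<cdot>\<^sub>m (X + Y))" "j < dim_col (r \<cdot>\<^sub>m (X + Y))"
    then have ij: "i < n" "j < n" using Y by auto
    have "0 \<le> Y $$ (i, j)" using nn(2) Y ij by (simp add: nonneg_mat_iff)
    then have "1 * Y $$ (i, j) \<le> r * Y $$ (i, j)" using r by (intro mult_right_mono)
    then show "(r \<cdot>\<^sub>m X + Y) $$ (i, j) \<le> (r \<cdot>\<^sub>m (X + Y)) $$ (i, j)"
      using ij X Y by (simp add: distrib_left)
  qed (use X Y in auto)
  then have "transpose_mat (r \<cdot>\<^sub>m X + Y) *\<^sub>v u \<le> transpose_mat (r \<cdot>\<^sub>m (X + Y)) *\<^sub>v u"
    using u Y by (intro mult_mat_vec_mono_left transpose_mat_mono) auto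
  also have "transpose_mat (r \<cdot>\<^sub>m (X + Y)) = r \<cdot>\<^sub>m transpose_mat (X + Y)"
    by (intro eq_matI) auto
  also have "\<dots> *\<^sub>v u = r \<cdot>\<^sub>v (transpose_mat (X + Y) *\<^sub>v u)"
    using u Y by (intro smult_mat_mult_vec) simp
  finally have le': "r\<^sup>2 \<cdot>\<^sub>v u \<le> r \<cdot>\<^sub>v (transpose_mat (X + Y) *\<^sub>v u)"
    using le by (rule order_trans[rotated])
  \<comment> \<open>Cancel one factor \<open>r\<close>, then drop the other, as r >= 1 and u >=
    0.\<close>
  have "u \<le> transpose_mat (X + Y) *\<^sub>v u"
    unfolding less_eq_vec_def
  proof (intro conjI allI impI)
    fix i assume "i < dim_vec (transpose_mat (X + Y) *\<^sub>v u)"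
    then have i: "i < n" using Y by simp
    define t where "t = (transpose_mat (X + Y) *\<^sub>v u) $ i"
    have "r\<^sup>2 * u $ i \<le> r * t"
      using le' i u Y by (auto simp: less_eq_vec_def t_def)
    then have "r * (r * u $ i) \<le> r * t" by (simp add: power2_eq_square mult.assoc)
    then have "r * u $ i \<le> t" using \<open>0 < r\<close> by (rule mult_left_le_imp_le)
    moreover have "0 \<le> u $ i" using u i by (auto simp: less_eq_vec_def)
    then have "1 * u $ i \<le> r * u $ i" using r by (intro mult_right_mono)
    ultimately show "u $ i \<le> (transpose_mat (X + Y) *\<^sub>v u) $ i" by (simp add: t_def)
  qed (use u Y in auto)
  from subinvariant_vec_eq_0[OF T B H Z nnB HB TB u(1,2) this] u(3)
  show False by simp
qed

section \<open>Two-stage splittings\<close>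

text \<open>\<open>P * mp_inverse P\<close> fixes every vector in the range of \<open>P\<close>,
  hence every column of \<open>S\<close>.\<close>

lemma mult_mp_inverse_range:
  assumes P: "P \<in> carrier_mat m n" and S: "S \<in> carrier_mat m k"
    and sub: "mat_range S \<subseteq> mat_range P"
  shows "P * mp_inverse P * S = S"
proof (rule mat_col_eqI)
  fix j assume j: "j < dim_col S"
  have "col S j = S *\<^sub>v unit_vec k j" using S j by auto
  then have "col S j \<in> mat_range S" using S j by (auto simp: mat_range_def)
  then obtain w where w: "w \<in> carrier_vec n" "col S j = P *\<^sub>v w"
    using sub P by (auto simp: mat_range_def)
  have PP: "P * mp_inverse P \<in> carrier_mat m m" using P by (auto intro!: carrier_matI)
  have "col (P * mp_inverse P * S) j = (P * mp_inverse P) *\<^sub>v (P *\<^sub>v w)"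
    using col_mult2[OF PP S] j S w by simp
  also have "\<dots> = (P * mp_inverse P * P) *\<^sub>v w"
    using assoc_mult_mat_vec[OF PP P w(1)] by simp
  finally show "col (P * mp_inverse P * S) j = col S j" by (simp add: mp_inverse w)
qed (use P S in auto)

text \<open>The complementary projector \<open>D\<close> satisfies \<open>P * D = 0\<close>, so its
  columns lie in the kernel of \<open>P\<close> and are killed by \<open>S\<close>.\<close>

lemma mult_mp_inverse_kernel:
  assumes P: "P \<in> carrier_mat m n" and S: "S \<in> carrier_mat k n"
    and sub: "mat_kernel P \<subseteq> mat_kernel S"
  shows "S * (mp_inverse P * P) = S"
proof -
  let ?Q = "mp_inverse P * P"
  have Q: "?Q \<in> carrier_mat n n" using P by (auto intro!: carrier_matI)
  define D where "D = 1\<^sub>m n - ?Q"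
  have D: "D \<in> carrier_mat n n" unfolding D_def by (rule minus_carrier_mat[OF Q])
  have d: "dim_row P = m" "dim_col P = n" "dim_row S = k" "dim_col S = n" using P S by auto
  have "P * D = P - P * mp_inverse P * P"
    using d by (simp add: D_def mat_algebra)
  then have PD: "P * D = 0\<^sub>m m n" using P by (simp add: mp_inverse)
  have SD: "S * D = 0\<^sub>m k n"
  proof (rule mat_col_eqI)
    fix j assume "j < dim_col (0\<^sub>m k n :: real mat)"
    then have j: "j < n" by simp
    have "P *\<^sub>v col D j = col (P * D) j" using col_mult2[OF P D j] by simp
    then have "col D j \<in> mat_kernel P"
      using P D j by (intro mat_kernelI[OF P]) (auto simp: PD)
    then have "S *\<^sub>v col D j = 0\<^sub>v k" using sub mat_kernelD[OF S] by auto
    then show "col (S * D) j = col (0\<^sub>m k n) j"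
      using col_mult2[OF S D j] j by simp
  qed (use S D in auto)
  have "S * D = S - S * ?Q" using d by (simp add: D_def mat_algebra)
  with SD have 0: "S - S * ?Q = 0\<^sub>m k n" by simp
  show ?thesis
  proof (rule eq_matI)
    fix i j assume ij: "i < dim_row S" "j < dim_col S"
    then have "(S - S * ?Q) $$ (i, j) = 0" unfolding 0 using d by simp
    moreover have "(S - S * ?Q) $$ (i, j) = S $$ (i, j) - (S * ?Q) $$ (i, j)"
      using ij d by (intro index_minus_mat) auto
    ultimately show "(S * ?Q) $$ (i, j) = S $$ (i, j)" by simp
  qed (use d in auto)
qed

text \<open>Both sides are the orthogonal projector along the common kernel: they are symmetric and
  absorb each other, so transposition identifies them.\<close>

lemma mp_inverse_mult_eq:
  assumes P: "P \<in> carrier_mat m n" and P': "P' \<in> carrier_mat k n"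
    and eq: "mat_kernel P = mat_kernel P'"
  shows "mp_inverse P * P = mp_inverse P' * P'"
proof -
  have d: "dim_row P = m" "dim_col P = n" "dim_row P' = k" "dim_col P' = n" using P P' by auto
  have 1: "P' * (mp_inverse P * P) = P'" and 2: "P * (mp_inverse P' * P') = P"
    using mult_mp_inverse_kernel[OF P P'] mult_mp_inverse_kernel[OF P' P] eq by auto
  have "mp_inverse P * P = mp_inverse P * P * (mp_inverse P' * P')"
    using 2 d by (simp add: mat_mult_assoc)
  also have "\<dots> = transpose_mat (mp_inverse P * P) * transpose_mat (mp_inverse P' * P')"
    by (simp only: mp_inverse)
  also have "\<dots> = transpose_mat (mp_inverse P' * P' * (mp_inverse P * P))"
    using d by (subst mat_transpose_mult) auto
  also have "mp_inverse P' * P' * (mp_inverse P * P) = mp_inverse P' * P'"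
    using 1 d by (simp add: mat_mult_assoc)
  finally show ?thesis by (simp only: mp_inverse)
qed

text \<open>A nonzero kernel vector of 1 - M would be an eigenvector of \<open>M\<close> for 1, also
  over the complex numbers; so the determinant is nonzero.\<close>

lemma one_minus_invertible:
  assumes M: "M \<in> carrier_mat m m" and "1 \<notin> rspectrum M"
  obtains K where "K \<in> carrier_mat m m" "(1\<^sub>m m - M) * K = 1\<^sub>m m"
proof -
  let ?D = "1\<^sub>m m - M"
  have D: "?D \<in> carrier_mat m m" by (rule minus_carrier_mat[OF M])
  have "det ?D \<noteq> 0"
  proof
    assume "det ?D = 0"
    then obtain v where v: "v \<in> carrier_vec m" "v \<noteq> 0\<^sub>v m" "?D *\<^sub>v v = 0\<^sub>v m"
      using det_0_iff_vec_prod_zero_field[OF D] by auto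
    have "?D *\<^sub>v v = v - M *\<^sub>v v"
      using v M by (subst minus_mult_distrib_mat_vec[of _ m m]) auto
    then have 0: "v - M *\<^sub>v v = 0\<^sub>v m" using v by simp
    have "M *\<^sub>v v = 1 \<cdot>\<^sub>v v"
    proof (rule eq_vecI)
      fix i assume "i < dim_vec (1 \<cdot>\<^sub>v v)"
      then have i: "i < m" using v by simp
      then have "(v - M *\<^sub>v v) $ i = 0" unfolding 0 by simp
      then show "(M *\<^sub>v v) $ i = (1 \<cdot>\<^sub>v v) $ i" using i v M by simp
    qed (use v M in auto)
    then have "eigenvalue M 1" using v M by (auto simp: eigenvalue_def eigenvector_def)
    then have "eigenvalue (map_mat complex_of_real M) (complex_of_real 1)"
      by (rule of_real_hom.eigenvalue_hom[OF M])
    with assms show False by (simp add: rspectrum_def spectrum_def)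
  qed
  \<comment> \<open>\<open>()\<close> fills a parameter of the record \<open>ring_mat\<close> whose
    value is arbitrary.\<close>
  from det_non_zero_imp_unit[OF D this, of "()"] show thesis
    using that by (auto simp: Units_def ring_mat_def)
qed

lemma nonneg_mat_mult_nonpos:
  assumes "nonpos_mat E" "nonpos_mat G" "dim_col E = dim_row G"
  shows "nonneg_mat (E * G)"
  using assms
  by (auto simp: nonneg_mat_iff nonpos_mat_def less_eq_mat_def scalar_prod_def
      intro!: sum_nonneg mult_nonpos_nonpos)

lemma nonneg_mat_diff_mult:
  assumes D: "D \<in> carrier_mat n k" and E: "E \<in> carrier_mat n l" and F: "F \<in> carrier_mat l k"
    and nn: "nonneg_mat D" "nonpos_mat E" "nonneg_mat F"
  shows "nonneg_mat (D - E * F)"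
  unfolding nonneg_mat_iff
proof (intro allI impI)
  fix i j assume "i < dim_row (D - E * F)" "j < dim_col (D - E * F)"
  then have ij: "i < n" "j < k" using E F by auto
  have "(E * F) $$ (i, j) = (\<Sum>x<l. E $$ (i, x) * F $$ (x, j))"
    using ij E F by (simp add: scalar_prod_def atLeast0LessThan)
  also have "\<dots> \<le> 0"
    using ij E F nn(2,3)
    by (intro sum_nonpos mult_nonpos_nonneg)
      (auto simp: nonneg_mat_iff nonpos_mat_def less_eq_mat_def)
  moreover have "0 \<le> D $$ (i, j)" using nn(1) D ij by (auto simp: nonneg_mat_iff)
  ultimately show "0 \<le> (D - E * F) $$ (i, j)" using ij E F by simp
qed

section \<open>Analysis of one two-stage splitting\<close>

text \<open>Stated for one pair of splittings so that it serves both. The radius bound rests on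
  \<open>N = B + (X + Y) * N\<close>, where \<open>N\<close> inverts \<open>H\<close> in the
  Moore-Penrose sense. This holds because the range of \<open>P2\<close> lies in that of
  \<open>H\<close> and \<open>H\<close> vanishes on the kernel of \<open>P2\<close>.\<close>

lemma two_stage_splitting:
  fixes m n :: nat and A P1 R1 S1 P2 R2 S2 :: "real mat"
  assumes "0 < n"
    and sp1: "double_proper_weak_regular m n A P1 R1 S1"
    and sp2: "double_proper_weak_regular m n A P2 R2 S2"
    and ker: "mat_kernel P2 \<subseteq> mat_kernel S2" and range: "mat_range S2 \<subseteq> mat_range P2"
    and sig: "1 \<notin> rspectrum (S2 * mp_inverse P1)"
    and hat: "nonneg_mat (mp_inverse ((1\<^sub>m m - S2 * mp_inverse P1) * A))"
  defines "X \<equiv> mp_inverse P2 * R2 - mp_inverse P2 * S2 * mp_inverse P1 * R1"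
    and "Y \<equiv> mp_inverse P2 * S2 * mp_inverse P1 * S1"
  shows "X \<in> carrier_mat n n" "Y \<in> carrier_mat n n" "nonneg_mat X" "nonneg_mat Y"
    "mp_inverse P2 * (R2 - S2 * mp_inverse P1 * R1) = X"
    "X + Y = mp_inverse P2 * P2 - mp_inverse P2 * ((1\<^sub>m m - S2 * mp_inverse P1) * A)"
    "rspectral_radius (iter_mat n P1 R1 S1 P2 R2 S2) < 1"
proof -
  have P1: "P1 \<in> carrier_mat m n" and R1: "R1 \<in> carrier_mat m n" and S1: "S1 \<in> carrier_mat m n"
    and P2: "P2 \<in> carrier_mat m n" and R2: "R2 \<in> carrier_mat m n" and S2: "S2 \<in> carrier_mat m n"
    and A: "A \<in> carrier_mat m n"
    and A1: "A = P1 - R1 + S1" and A2: "A = P2 - R2 + S2"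
    and ran2: "mat_range P2 = mat_range A" and ker1: "mat_kernel P1 = mat_kernel A"
    and ker2: "mat_kernel P2 = mat_kernel A"
    and nnB: "nonneg_mat (mp_inverse P2)"
    and nnF: "nonneg_mat (mp_inverse P1 * R1)" and npG: "nonpos_mat (mp_inverse P1 * S1)"
    and nnD: "nonneg_mat (mp_inverse P2 * R2)" and npE: "nonpos_mat (mp_inverse P2 * S2)"
    using sp1 sp2
    by (auto simp: double_proper_weak_regular_def double_proper_splitting_def double_splitting_def)
  define B C where "B = mp_inverse P2" and "C = mp_inverse P1"
  have B: "B \<in> carrier_mat n m" and C: "C \<in> carrier_mat n m"
    using P1 P2 by (auto simp: B_def C_def intro!: carrier_matI)
  note d = carrier_matD[OF P1] carrier_matD[OF R1] carrier_matD[OF S1] carrier_matD[OF P2]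
    carrier_matD[OF R2] carrier_matD[OF S2] carrier_matD[OF A] carrier_matD[OF B] carrier_matD[OF C]
  \<comment> \<open>The signs are E <= 0, F >= 0 and G <= 0, so \<open>B * R2 - E * F\<close> and
    \<open>E * G\<close> are nonnegative.\<close>
  define E F G where "E = B * S2" and "F = C * R1" and "G = C * S1"
  have E: "E \<in> carrier_mat n n" and F: "F \<in> carrier_mat n n" and G: "G \<in> carrier_mat n n"
    using B C R1 S1 S2 by (auto simp: E_def F_def G_def)
  have BR: "B * R2 \<in> carrier_mat n n" using B R2 by simp
  have X_eq: "X = B * R2 - E * F" and Y_eq: "Y = E * G"
    using d by (simp_all add: X_def Y_def B_def[symmetric] C_def[symmetric] E_def F_def G_def mat_mult_assoc)
  show X: "X \<in> carrier_mat n n" and Y: "Y \<in> carrier_mat n n"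
    using E F G BR by (auto simp: X_eq Y_eq)
  show nnX: "nonneg_mat X"
    unfolding X_eq
    by (rule nonneg_mat_diff_mult[OF BR E F]) (use nnD npE nnF in \<open>simp_all add: B_def C_def E_def F_def\<close>)
  show nnY: "nonneg_mat Y"
    unfolding Y_eq
    by (rule nonneg_mat_mult_nonpos) (use npE npG d in \<open>simp_all add: B_def C_def E_def G_def\<close>)
  show "mp_inverse P2 * (R2 - S2 * mp_inverse P1 * R1) = X"
    unfolding B_def[symmetric] C_def[symmetric] X_eq E_def F_def
    using d by (simp add: mat_mult_assoc mat_mult_diff_distrib)
  define M where "M = S2 * C"
  have M: "M \<in> carrier_mat m m" using S2 C by (simp add: M_def)
  define H where "H = (1\<^sub>m m - M) * A"
  have H: "H \<in> carrier_mat m n" unfolding H_def by (rule mult_carrier_mat[OF minus_carrier_mat[OF M] A])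
  define N where "N = mp_inverse H"
  have N: "N \<in> carrier_mat n m" using H by (auto simp: N_def intro!: carrier_matI)
  note d = d carrier_matD[OF M] carrier_matD[OF H] carrier_matD[OF N]
  \<comment> \<open>\<open>P1\<close> and \<open>P2\<close> share the kernel of \<open>A\<close>, so
    \<open>S2\<close> vanishes on the kernel of \<open>P1\<close>.\<close>
  have S2Q: "S2 * (C * P1) = S2"
    unfolding C_def using mult_mp_inverse_kernel[OF P1 S2] ker ker1 ker2 by simp
  \<comment> \<open>The second splitting expands \<open>B * A\<close>, the first expands
    \<open>C * A\<close>; in the difference \<open>B * H\<close> the term \<open>E\<close>
    cancels.\<close>
  have "B * A = B * P2 - B * R2 + E"
    unfolding A2 E_def using d by (simp add: mat_mult_diff_distrib mat_mult_add_distrib)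
  moreover have "B * (S2 * (C * A)) = E - E * F + E * G"
  proof -
    have "B * (S2 * (C * A)) = B * (S2 * (C * P1)) - B * (S2 * (C * R1)) + B * (S2 * (C * S1))"
      unfolding A1 using d by (simp add: mat_mult_diff_distrib mat_mult_add_distrib)
    then show ?thesis
      unfolding S2Q using d by (simp add: E_def F_def G_def mat_mult_assoc)
  qed
  moreover have "B * H = B * A - B * (S2 * (C * A))"
    using d by (simp add: H_def M_def mat_algebra)
  ultimately have BH: "B * H = (B * P2 - B * R2 + E) - (E - E * F + E * G)" by simp
  have XY: "X + Y = B * P2 - B * H"
    unfolding BH X_eq Y_eq using d E F G by (intro eq_matI) auto
  then show "X + Y = mp_inverse P2 * P2 - mp_inverse P2 * ((1\<^sub>m m - S2 * mp_inverse P1) * A)"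
    by (simp add: B_def H_def M_def C_def)
  \<comment> \<open>This exhibits \<open>X + Y\<close> as a right multiple of \<open>B\<close>, as
    the convergence lemma requires.\<close>
  have "B * P2 - B * H = B * (P2 - H)"
    using d by (simp add: mat_mult_diff_distrib)
  with XY have XYZ: "X + Y = B * (P2 - H)" by simp

  obtain K where K: "K \<in> carrier_mat m m" and DK: "(1\<^sub>m m - M) * K = 1\<^sub>m m"
    using one_minus_invertible[OF M] sig by (auto simp: M_def C_def)
  note d = d carrier_matD[OF K]
  define J where "J = mp_inverse A"
  have J: "J \<in> carrier_mat n m" using A by (auto simp: J_def intro!: carrier_matI)
  note d = d carrier_matD[OF J]
  \<comment> \<open>\<open>A * J\<close> is the projector onto the range of
    \<open>A\<close>.\<close>
  have AJ: "A * J * V = V" if "V \<in> carrier_mat m n" "mat_range V \<subseteq> mat_range A" for V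
    unfolding J_def using that by (intro mult_mp_inverse_range[OF A])
  have AJP2: "A * J * P2 = P2" and AJS2: "A * J * S2 = S2" and AJA: "A * J * A = A"
    using AJ P2 S2 A range ran2 by auto
  text \<open>The inverse \<open>K\<close> of \<open>1 - M\<close> maps the range of \<open>A\<close> into itself, since
    \<open>K = 1 + M * K\<close> and the range of \<open>M\<close> is contained in that of \<open>A\<close>.\<close>
  have "K - M * K = 1\<^sub>m m" using DK d by (simp add: mat_algebra)
  have KMK: "K = 1\<^sub>m m + M * K"
  proof (rule eq_matI)
    fix i j assume "i < dim_row (1\<^sub>m m + M * K)" "j < dim_col (1\<^sub>m m + M * K)"
    then have ij: "i < m" "j < m" using d by auto
    have "(K - M * K) $$ (i, j) = (1\<^sub>m m) $$ (i, j)" using \<open>K - M * K = 1\<^sub>m m\<close> by simp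
    then show "K $$ (i, j) = (1\<^sub>m m + M * K) $$ (i, j)" using ij d by simp
  qed (use d in auto)
  have KA: "K * A = A + S2 * (C * (K * A))"
  proof -
    have "K * A = (1\<^sub>m m + M * K) * A" using KMK by simp
    then show ?thesis using d by (simp add: M_def mat_algebra)
  qed
  have AJKA: "A * J * (K * A) = K * A"
  proof -
    have "A * J * (A + S2 * (C * (K * A))) = A * J * A + A * J * S2 * (C * (K * A))"
      using d by (simp add: mat_mult_assoc mat_mult_add_distrib)
    then show ?thesis unfolding AJA AJS2 KA[symmetric] .
  qed
  \<comment> \<open>An explicit preimage of \<open>A\<close> under \<open>H\<close>, showing that
    the range of \<open>A\<close> lies in that of \<open>H\<close>; so \<open>H * N\<close> fixes
    \<open>A\<close> and with it \<open>P2\<close>.\<close>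
  have HL: "H * (J * (K * A)) = A"
  proof -
    have "H * (J * (K * A)) = (1\<^sub>m m - M) * (A * J * (K * A))"
      unfolding H_def using d by (simp add: mat_mult_assoc)
    also have "\<dots> = ((1\<^sub>m m - M) * K) * A"
      unfolding AJKA using d by (subst mat_mult_assoc) auto
    finally show ?thesis using A by (simp add: DK)
  qed
  have HNA: "H * N * A = A"
  proof -
    have "H * N * (H * (J * (K * A))) = (H * N * H) * (J * (K * A))"
      using d by (simp add: mat_mult_assoc)
    moreover have "H * N * H = H" by (simp only: N_def mp_inverse)
    ultimately show ?thesis by (simp only: HL)
  qed
  have HNP2: "H * N * P2 = P2"
  proof -
    have "H * N * (A * J * P2) = (H * N * A) * J * P2" using d by (simp add: mat_mult_assoc)
    then show ?thesis unfolding HNA AJP2 .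
  qed
  \<comment> \<open>Both factors are symmetric projectors, so transposition moves the absorption
    \<open>H * N * P2 = P2\<close> to the other side.\<close>
  have "P2 * B * (H * N) = transpose_mat (P2 * B) * transpose_mat (H * N)"
    by (simp only: B_def N_def mp_inverse)
  also have "\<dots> = transpose_mat (H * N * (P2 * B))"
    using d by (subst mat_transpose_mult) auto
  also have "H * N * (P2 * B) = H * N * P2 * B" using d by (simp add: mat_mult_assoc)
  also have "\<dots> = P2 * B" by (simp only: HNP2)
  finally have PBHN: "P2 * B * (H * N) = P2 * B" by (simp only: B_def mp_inverse)
  have BHN: "B * (H * N) = B"
  proof -
    have "B * (H * N) = B * P2 * B * (H * N)" by (simp only: B_def mp_inverse)
    also have "\<dots> = B * (P2 * B * (H * N))" using d by (simp add: mat_mult_assoc)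
    also have "\<dots> = B * P2 * B" unfolding PBHN using d by (simp add: mat_mult_assoc)
    finally show ?thesis by (simp only: B_def mp_inverse)
  qed
  have AQ: "A * (B * P2) = A"
    unfolding B_def using ker2 by (intro mult_mp_inverse_kernel[OF P2 A]) simp
  have HQ: "H * (B * P2) = H"
    unfolding H_def using AQ d by (simp add: mat_mult_assoc)
  \<comment> \<open>The same transposition on the kernel side, starting from
    \<open>HQ\<close>.\<close>
  have "B * P2 * (N * H) = transpose_mat (B * P2) * transpose_mat (N * H)"
    by (simp only: B_def N_def mp_inverse)
  also have "\<dots> = transpose_mat (N * H * (B * P2))"
    using d by (subst mat_transpose_mult) auto
  also have "N * H * (B * P2) = N * H" using HQ d by (simp add: mat_mult_assoc)
  finally have QNH: "B * P2 * (N * H) = N * H" by (simp only: N_def mp_inverse)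
  have QN: "B * P2 * N = N"
  proof -
    have "B * P2 * N = B * P2 * (N * H * N)" by (simp only: N_def mp_inverse)
    also have "\<dots> = B * P2 * (N * H) * N" using d by (simp add: mat_mult_assoc)
    also have "\<dots> = N" unfolding QNH by (simp only: N_def mp_inverse)
    finally show ?thesis .
  qed
  have "(X + Y) * N = B * P2 * N - B * (H * N)"
    unfolding XY using d by (simp add: mat_mult_assoc mat_diff_mult_distrib)
  then have XYN: "(X + Y) * N = N - B" by (simp only: QN BHN)
  have NB: "N = B + (X + Y) * N"
    unfolding XYN by (rule eq_matI) (simp_all add: carrier_matD[OF B] carrier_matD[OF N])
  have "rspectral_radius (companion_mat n X Y) < 1"
  proof (rule rspectral_radius_companion_less_1[OF X Y nnX nnY \<open>0 < n\<close> B N _ _ _ NB XYZ])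
    show "P2 - H \<in> carrier_mat m n" by (rule minus_carrier_mat[OF H])
    show "nonneg_mat B" "nonneg_mat N"
      using nnB hat by (simp_all add: B_def N_def H_def M_def C_def)
  qed
  then show "rspectral_radius (iter_mat n P1 R1 S1 P2 R2 S2) < 1"
    by (simp add: iter_mat_def X_def Y_def)
qed

section \<open>Comparison of the two iteration matrices\<close>

theorem theorem3p13:
  fixes m n :: nat and A P1 R1 S1 P2 R2 S2 P3 R3 S3 P4 R4 S4 :: "real mat"
  assumes n_pos: "n > 0"
    and A: "A \<in> carrier_mat m n" and semi: "semi_monotone A"
    and sp1: "double_proper_weak_regular m n A P1 R1 S1"
    and sp2: "double_proper_weak_regular m n A P2 R2 S2"
    and sp3: "double_proper_weak_regular m n A P3 R3 S3"
    and sp4: "double_proper_weak_regular m n A P4 R4 S4"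
    and N2: "mat_kernel P2 \<subseteq> mat_kernel S2" and R2: "mat_range S2 \<subseteq> mat_range P2"
    and N4: "mat_kernel P4 \<subseteq> mat_kernel S4" and R4: "mat_range S4 \<subseteq> mat_range P4"
    and sig1: "1 \<notin> rspectrum (S2 * mp_inverse P1)"
    and sig2: "1 \<notin> rspectrum (S4 * mp_inverse P3)"
    and hat1: "nonneg_mat (mp_inverse ((1\<^sub>m m - S2 * mp_inverse P1) * A))"
    and hat2: "nonneg_mat (mp_inverse ((1\<^sub>m m - S4 * mp_inverse P3) * A))"
    and cmpA: "mp_inverse P2 * ((1\<^sub>m m - S2 * mp_inverse P1) * A)
               \<ge> mp_inverse P4 * ((1\<^sub>m m - S4 * mp_inverse P3) * A)"
    and cmpR: "mp_inverse P2 * (R2 - S2 * mp_inverse P1 * R1)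
               \<ge> mp_inverse P4 * (R4 - S4 * mp_inverse P3 * R3)"
  shows "rspectral_radius (iter_mat n P1 R1 S1 P2 R2 S2)
           \<le> rspectral_radius (iter_mat n P3 R3 S3 P4 R4 S4)
         \<and> rspectral_radius (iter_mat n P3 R3 S3 P4 R4 S4) < 1"
proof -
  note t1 = two_stage_splitting[OF n_pos sp1 sp2 N2 R2 sig1 hat1]
  note t2 = two_stage_splitting[OF n_pos sp3 sp4 N4 R4 sig2 hat2]
  have P: "P2 \<in> carrier_mat m n" "P4 \<in> carrier_mat m n" "mat_kernel P2 = mat_kernel P4"
    using sp2 sp4
    by (auto simp: double_proper_weak_regular_def double_proper_splitting_def double_splitting_def)
  \<comment> \<open>Both kernels are that of \<open>A\<close>, so the two sums of blocks are
    differences from the same projector.\<close>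
  have Q: "mp_inverse P2 * P2 = mp_inverse P4 * P4"
    by (rule mp_inverse_mult_eq[OF P])
  let ?X1 = "mp_inverse P2 * R2 - mp_inverse P2 * S2 * mp_inverse P1 * R1"
  let ?Y1 = "mp_inverse P2 * S2 * mp_inverse P1 * S1"
  let ?X2 = "mp_inverse P4 * R4 - mp_inverse P4 * S4 * mp_inverse P3 * R3"
  let ?Y2 = "mp_inverse P4 * S4 * mp_inverse P3 * S3"
  \<comment> \<open>The product compared in \<open>cmpA\<close> enters with a minus sign, which
    reverses the inequality.\<close>
  have "?X1 + ?Y1 \<le> ?X2 + ?Y2"
    unfolding t1(6) t2(6) Q using cmpA by (auto simp: less_eq_mat_def)
  \<comment> \<open>\<open>t1(7)\<close> supplies radius at most 1 for the smaller side, and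
    \<open>cmpR\<close> is the comparison of the first blocks.\<close>
  then have "rspectral_radius (companion_mat n ?X1 ?Y1) \<le> rspectral_radius (companion_mat n ?X2 ?Y2)"
    using t1(7) cmpR unfolding t1(5) t2(5) iter_mat_def
    by (intro rspectral_radius_companion_mono[OF t1(1,2) t2(1,2) t1(3,4) t2(3,4) n_pos]) auto
  then show ?thesis using t2(7) by (simp add: iter_mat_def)
qed

end
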